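(* Let $n$ and $k$ be integers with $k \geq 3$ and $n \geq 4k^2 - 4k + 3$, and let $G = \mathrm{Kneser}(n,k)$. Then $$\mathrm{tw}(G) = \binom{n-1}{k} - 1.$$
   Context: For positive integers $n,k$, the Kneser graph $\mathrm{Kneser}(n,k)$ has as vertex set the family of all $k$-element subsets of $[n]=\{1,\dots,n\}$, with two vertices adjacent if and only if they are disjoint sets. A tree decomposition of a graph $G$ is a pair $(T,(B_x)_{x\in V(T)})$ with $T$ a tree and $B_x\subseteq V(G)$, such that for each vertex $v$ the nodes $x$ with $v\in B_x$ induce a non-empty connected subtree of $T$, and each edge of $G$ has both ends in some bag $B_x$. Its width is $\max_x |B_x| - 1$, and the treewidth $\mathrm{tw}(G)$ is the minimum width of a tree decomposition of $G$. *)

theory Defs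
  imports "Graph_Theory.Digraph_Component"
begin

text \<open>
  Finite simple graphs are the symmetric loop-free pair digraphs of the locale \<^locale>\<open>pair_graph\<close>:
  an undirected edge is a pair of opposite arcs. The library's \<^const>\<open>tree\<close> excludes all directed
  cycles, hence also the closed walk \<open>a, b, a\<close> along a single undirected edge. A cycle of a simple
  graph is therefore a \<^const>\<open>pre_digraph.cycle\<close> of length at least 3.
\<close>

definition undirected_tree :: "'a pair_pre_digraph \<Rightarrow> bool" where
  "undirected_tree T \<longleftrightarrow> pair_graph T \<and> connected (with_proj T) \<and>
     \<not> (\<exists>p. pre_digraph.cycle (with_proj T) p \<and> 3 \<le> length p)"

text \<open>
  The predicate \<^const>\<open>connected\<close> includes non-emptiness, and a connected induced subgraph of a
  tree is a tree.
\<close>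

definition tree_decomposition ::
  "'a pair_pre_digraph \<Rightarrow> 'x pair_pre_digraph \<Rightarrow> ('x \<Rightarrow> 'a set) \<Rightarrow> bool" where
  "tree_decomposition G T B \<longleftrightarrow>
     undirected_tree T \<and>
     (\<forall>x \<in> pverts T. B x \<subseteq> pverts G) \<and>
     (\<forall>v \<in> pverts G. connected (with_proj T \<restriction> {x \<in> pverts T. v \<in> B x})) \<and>
     (\<forall>(u, v) \<in> parcs G. \<exists>x \<in> pverts T. u \<in> B x \<and> v \<in> B x)"

definition decomposition_width :: "'x pair_pre_digraph \<Rightarrow> ('x \<Rightarrow> 'a set) \<Rightarrow> int" where
  "decomposition_width T B = Max ((\<lambda>x. int (card (B x))) ` pverts T) - 1"

text \<open>
  Trees are finite, so up to isomorphism their nodes are natural numbers.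
\<close>

definition treewidth :: "'a pair_pre_digraph \<Rightarrow> int" where
  "treewidth G = (LEAST w. \<exists>(T :: nat pair_pre_digraph) B.
     tree_decomposition G T B \<and> w = decomposition_width T B)"

definition kneser :: "nat \<Rightarrow> nat \<Rightarrow> nat set pair_pre_digraph" where
  "kneser n k =
     (let V = {A. A \<subseteq> {1..n} \<and> card A = k}
      in \<lparr> pverts = V, parcs = {(A, B). A \<in> V \<and> B \<in> V \<and> A \<inter> B = {}} \<rparr>)"

lemma pair_graph_kneser:
  assumes "k \<ge> 1"
  shows "pair_graph (kneser n k)"
proof -
  define V where "V = {A :: nat set. A \<subseteq> {1..n} \<and> card A = k}"
  have K: "pverts (kneser n k) = V"
    "parcs (kneser n k) = {(A, B). A \<in> V \<and> B \<in> V \<and> A \<inter> B = {}}"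
    by (simp_all add: kneser_def V_def Let_def)
  have fin: "finite V" by (simp add: V_def)
  have "parcs (kneser n k) \<subseteq> V \<times> V" by (auto simp: K)
  then have finp: "finite (parcs (kneser n k))" using fin by (meson finite_SigmaI finite_subset)
  have ne: "A \<noteq> {}" if "A \<in> V" for A
    using that assms by (auto simp: V_def)
  have sym: "symmetric (kneser n k)"
    by (simp add: symmetric_def sym_def K Int_commute)
  show ?thesis
  proof
    fix e assume "e \<in> parcs (kneser n k)"
    then have "fst e \<in> V" "snd e \<in> V" "fst e \<inter> snd e = {}" by (auto simp: K)
    then show "fst e \<in> pverts (kneser n k)" "snd e \<in> pverts (kneser n k)" "fst e \<noteq> snd e"
      using ne[of "fst e"] by (auto simp: K)
  qed (use fin finp sym K in simp_all)
qed

lemma tree_decomposition_trivial: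
  fixes x :: 'x
  assumes "pair_graph G"
  shows "tree_decomposition G \<lparr> pverts = {x}, parcs = {} \<rparr> (\<lambda>_. pverts G)"
proof -
  interpret pair_graph G by fact
  let ?T = "\<lparr> pverts = {x}, parcs = {} \<rparr> :: 'x pair_pre_digraph"
  have "pair_graph ?T"
    by unfold_locales (auto simp: symmetric_def sym_def)
  moreover have "connected (with_proj ?T)"
    by (auto simp: connected_def strongly_connected_def mk_symmetric_def reachable_def)
  moreover have "\<not> pre_digraph.cycle (with_proj ?T) p" for p
    by (auto simp: pre_digraph.cycle_def pre_digraph.awalk_def)
  ultimately have "undirected_tree ?T"
    by (simp add: undirected_tree_def)
  moreover have "connected (with_proj ?T \<restriction> {y \<in> pverts ?T. v \<in> pverts G})" if "v \<in> pverts G" for v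
    using that
    by (auto simp: connected_def strongly_connected_def mk_symmetric_def reachable_def)
  ultimately show ?thesis
    by (simp add: tree_decomposition_def case_prod_beta arc_fst_in_verts arc_snd_in_verts)
qed

end

theory Submission
  imports Defs
begin

text \<open>
  Upper bound: the sets containing 1 are independent. In a star-shaped decomposition, the centre
  carries all other vertices and each leaf carries the closed neighbourhood of one set containing 1.

  Lower bound: let \<open>N = (n - 1) choose (k - 1)\<close>. If the width is smaller than claimed, every bag
  misses more than \<open>N\<close> vertices. At each node, group the missed vertices by the branch of the tree
  that contains them. Either the groups at some node can be merged into two balanced parts, or every
  node has a neighbour whose branch carries more than two thirds of the missed vertices. In the
  latter case two adjacent nodes point at each other. Both cases give disjoint cross-intersecting
  families \<open>\<A>\<close>, \<open>\<B>\<close> of size at least \<open>N / 3\<close> each and of total size more than \<open>N\<close>.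

  No such families exist. If an element lies in more than \<open>N / 4\<close> members of one family, then it lies
  in all members of the other, then in all members of both, and the total size is at most \<open>N\<close>.
  Otherwise all degrees are at most \<open>N / 4\<close>, and they can be pushed down: if every set of \<open>s\<close> elements
  is missed by a member of \<open>\<A>\<close>, then all degrees in \<open>\<B>\<close> are at most \<open>N / 4 ^ s\<close>. Small degrees in
  turn mean that larger sets are missed. Finally some members of \<open>\<A>\<close> and \<open>\<B>\<close> are disjoint.
\<close>

section \<open>Cross-intersecting families\<close>

definition cross_intersecting :: "'a set set \<Rightarrow> 'a set set \<Rightarrow> bool" where
  "cross_intersecting \<A> \<B> \<longleftrightarrow> (\<forall>S\<in>\<A>. \<forall>T\<in>\<B>. S \<inter> T \<noteq> {})"

lemma cross_intersecting_commute: "cross_intersecting \<A> \<B> \<longleftrightarrow> cross_intersecting \<B> \<A>"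
  by (auto simp: cross_intersecting_def Int_commute)

text \<open>For a singleton \<open>I\<close> this is the degree of an element.\<close>

definition codegree :: "'a set set \<Rightarrow> 'a set \<Rightarrow> nat" where
  "codegree \<A> I = card {S \<in> \<A>. I \<subseteq> S}"

text \<open>No set of at most \<open>s\<close> elements is a transversal: the covering number of the
  family exceeds \<open>s\<close>.\<close>

definition avoids_all :: "'a set set \<Rightarrow> nat \<Rightarrow> bool" where
  "avoids_all \<A> s \<longleftrightarrow> (\<forall>I. finite I \<and> card I \<le> s \<longrightarrow> (\<exists>S\<in>\<A>. S \<inter> I = {}))"

definition uniform_family :: "'a set \<Rightarrow> nat \<Rightarrow> 'a set set \<Rightarrow> bool" where
  "uniform_family U k \<A> \<longleftrightarrow> (\<forall>S\<in>\<A>. S \<subseteq> U \<and> card S = k)"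

lemma finite_uniform_family:
  assumes "finite U" "uniform_family U k \<A>"
  shows "finite \<A>"
  using assms by (intro finite_subset[of \<A> "Pow U"]) (auto simp: uniform_family_def)

lemma uniform_family_member:
  assumes "finite U" "uniform_family U k \<A>" "S \<in> \<A>"
  shows "finite S" "card S = k"
  using assms finite_subset[of S U] by (auto simp: uniform_family_def)

lemma codegree_le_choose:
  assumes "finite U" "uniform_family U k \<A>"
  shows "codegree \<A> I \<le> (card U - card I) choose (k - card I)"
proof (cases "I \<subseteq> U")
  case True
  let ?F = "{S \<in> \<A>. I \<subseteq> S}" and ?G = "{R. R \<subseteq> U - I \<and> card R = k - card I}"
  have fI: "finite I" using True assms(1) finite_subset by blast
  have "inj_on (\<lambda>S. S - I) ?F" by (rule inj_onI) blast
  moreover have "(\<lambda>S. S - I) ` ?F \<subseteq> ?G"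
    using assms fI by (auto simp: uniform_family_def card_Diff_subset)
  moreover have "finite ?G" using assms(1) by auto
  ultimately have "card ?F \<le> card ?G" by (rule card_inj_on_le)
  also have "\<dots> = card (U - I) choose (k - card I)"
    using assms(1) by (simp add: n_subsets)
  also have "\<dots> = (card U - card I) choose (k - card I)"
    using True fI by (simp add: card_Diff_subset)
  finally show ?thesis by (simp add: codegree_def)
next
  case False
  then have "{S \<in> \<A>. I \<subseteq> S} = {}" using assms by (auto simp: uniform_family_def)
  then show ?thesis by (simp only: codegree_def card.empty)
qed

text \<open>Members of \<open>\<B>\<close> meet \<open>S\<close>, so one containing \<open>I\<close>
  contains \<open>insert j I\<close> for some \<open>j\<close> in \<open>S\<close>. A union bound
  over \<open>S\<close> finishes.\<close>

lemma codegree_extend: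
  assumes "cross_intersecting \<A> \<B>" "finite \<B>" "S \<in> \<A>" "finite S"
    and "\<And>j. j \<in> S \<Longrightarrow> codegree \<B> (insert j I) \<le> D"
  shows "codegree \<B> I \<le> card S * D"
proof -
  have "{T \<in> \<B>. I \<subseteq> T} \<subseteq> (\<Union>j\<in>S. {T \<in> \<B>. insert j I \<subseteq> T})"
    using assms(1,3) by (fastforce simp: cross_intersecting_def)
  then have "codegree \<B> I \<le> card (\<Union>j\<in>S. {T \<in> \<B>. insert j I \<subseteq> T})"
    unfolding codegree_def using assms(2,4) by (intro card_mono) auto
  also have "\<dots> \<le> (\<Sum>j\<in>S. codegree \<B> (insert j I))"
    unfolding codegree_def using assms(4) by (rule card_UN_le)
  also have "\<dots> \<le> card S * D"
    using sum_bounded_above[of S "\<lambda>j. codegree \<B> (insert j I)" D] assms(5) by simp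
  finally show ?thesis .
qed

text \<open>While \<open>card I \<le> s\<close>, some \<open>S\<close> in \<open>\<A>\<close> avoids
  \<open>I\<close>, and branching over its elements costs a factor \<open>k\<close>. The exponent
  counts the branchings until \<open>I\<close> has \<open>Suc s\<close> elements, where counting all
  supersets suffices.\<close>

lemma codegree_le_if_avoids_all:
  assumes "finite U" "uniform_family U k \<A>" "uniform_family U k \<B>"
    and "cross_intersecting \<A> \<B>" "avoids_all \<A> s" "finite I" "card I \<le> Suc s"
  shows "codegree \<B> I \<le> k ^ (Suc s - card I) * ((card U - Suc s) choose (k - Suc s))"
  using assms(6,7)
proof (induction "Suc s - card I" arbitrary: I)
  case 0
  then have "card I = Suc s" by simp
  then show ?case using codegree_le_choose[OF assms(1,3), of I] by simp
next
  case (Suc d)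
  then have "card I \<le> s" by simp
  then obtain S where S: "S \<in> \<A>" "S \<inter> I = {}"
    using assms(5) Suc.prems by (auto simp: avoids_all_def)
  note fS = uniform_family_member[OF assms(1,2) S(1)]
  have "codegree \<B> (insert j I) \<le> k ^ d * ((card U - Suc s) choose (k - Suc s))"
    if "j \<in> S" for j
  proof -
    have "j \<notin> I" using that S(2) by blast
    then have "card (insert j I) = Suc (card I)" using Suc.prems by simp
    then have "d = Suc s - card (insert j I)" "card (insert j I) \<le> Suc s"
      using Suc.hyps \<open>card I \<le> s\<close> by auto
    then show ?thesis using Suc.hyps(1)[of "insert j I"] Suc.prems by simp
  qed
  then have "codegree \<B> I \<le> k * (k ^ d * ((card U - Suc s) choose (k - Suc s)))"
    using codegree_extend[OF assms(4) finite_uniform_family[OF assms(1,3)] S(1) fS(1)] fS(2) by blast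
  then show ?case by (simp add: Suc.hyps(2)[symmetric] mult.assoc)
qed

text \<open>By absorption, lowering \<open>m\<close> and \<open>j\<close> by one divides the
  coefficient by \<open>m / j\<close>, hence by at least \<open>c\<close>. The condition
  \<open>c * j \<le> m\<close> survives the lowering.\<close>

lemma power_mult_choose_le:
  assumes "c * j \<le> m" "s \<le> j"
  shows "c ^ s * ((m - s) choose (j - s)) \<le> m choose j"
  using assms(2)
proof (induction s)
  case (Suc s)
  let ?m = "m - s" and ?j = "j - s"
  have j: "?j > 0" using Suc.prems by simp
  have "c * ?j \<le> ?m"
  proof (cases "c = 0")
    case False
    then have "s \<le> c * s" by simp
    moreover have "c * ?j = c * j - c * s" by (simp add: diff_mult_distrib2)
    ultimately show ?thesis using assms(1) by linarith
  qed simp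
  then have "?j * (c * ((?m - 1) choose (?j - 1))) \<le> ?m * ((?m - 1) choose (?j - 1))"
    using mult_le_mono1 by (metis mult.assoc mult.commute)
  also have "\<dots> = ?j * (?m choose ?j)"
    using times_binomial_minus1_eq[OF j] by simp
  finally have "c * ((?m - 1) choose (?j - 1)) \<le> ?m choose ?j" using j by simp
  then have "c ^ s * (c * ((?m - 1) choose (?j - 1))) \<le> c ^ s * (?m choose ?j)" by simp
  also have "\<dots> \<le> m choose j" using Suc by simp
  finally show ?case by (simp add: mult_ac)
qed simp

text \<open>The \<open>s\<close> branchings from \<open>{i}\<close> lose \<open>k ^ s\<close>, and
  the smaller binomial coefficient gains \<open>(4 * k) ^ s\<close>. The lower bound on
  \<open>card U\<close> provides the ratio \<open>4 * k\<close>.\<close>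

lemma degree_le_if_avoids_all:
  assumes "finite U" "uniform_family U k \<A>" "uniform_family U k \<B>"
    and "cross_intersecting \<A> \<B>" "avoids_all \<A> s" "s < k" "4 * k * (k - 1) \<le> card U - 1"
  shows "4 ^ s * codegree \<B> {i} \<le> (card U - 1) choose (k - 1)"
proof -
  have "4 ^ s * codegree \<B> {i} \<le> 4 ^ s * (k ^ s * ((card U - Suc s) choose (k - Suc s)))"
    using codegree_le_if_avoids_all[OF assms(1-5), of "{i}"] by simp
  also have "\<dots> = (4 * k) ^ s * ((card U - 1 - s) choose (k - 1 - s))"
    by (simp add: power_mult_distrib)
  also have "\<dots> \<le> (card U - 1) choose (k - 1)"
    using assms(6,7) by (intro power_mult_choose_le) auto
  finally show ?thesis .
qed

lemma avoids_all_if_small_degrees: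
  assumes "finite \<A>" "\<And>i. codegree \<A> {i} \<le> D" "s * D < card \<A>"
  shows "avoids_all \<A> s"
  unfolding avoids_all_def
proof (intro allI impI, rule ccontr)
  fix I assume I: "finite I \<and> card I \<le> s" and "\<not> (\<exists>S\<in>\<A>. S \<inter> I = {})"
  then have "\<A> \<subseteq> (\<Union>i\<in>I. {S \<in> \<A>. {i} \<subseteq> S})" by fastforce
  then have "card \<A> \<le> card (\<Union>i\<in>I. {S \<in> \<A>. {i} \<subseteq> S})"
    using I assms(1) by (intro card_mono) auto
  also have "\<dots> \<le> (\<Sum>i\<in>I. codegree \<A> {i})"
    unfolding codegree_def using I by (intro card_UN_le) auto
  also have "\<dots> \<le> card I * D"
    using sum_bounded_above[of I "\<lambda>i. codegree \<A> {i}" D] assms(2) by simp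
  also have "\<dots> \<le> s * D" using I by simp
  finally show False using assms(3) by simp
qed

text \<open>Degree bounds are kept in multiplied form; \<open>N div c\<close> appears only inside
  this proof.\<close>

lemma avoids_all_if_scaled_degrees:
  assumes "finite \<A>" "\<And>i. c * codegree \<A> {i} \<le> N" "s * N < c * card \<A>"
  shows "avoids_all \<A> s"
proof (rule avoids_all_if_small_degrees[OF assms(1)])
  have c: "c > 0" using assms(3) by (cases c) auto
  show "codegree \<A> {i} \<le> N div c" for i
    using assms(2)[of i] c by (simp add: less_eq_div_iff_mult_less_eq mult.commute)
  have "c * (s * (N div c)) \<le> s * N" by (metis mult.left_commute mult_le_mono2 times_div_less_eq_dividend)
  then have "c * (s * (N div c)) < c * card \<A>" using assms(3) by linarith
  then show "s * (N div c) < card \<A>" by simp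
qed

section \<open>Forcing a common element\<close>

text \<open>If \<open>i \<notin> S\<close>, each member of \<open>\<B>\<close> through
  \<open>i\<close> also contains some \<open>j \<noteq> i\<close> of \<open>S\<close>. There are at
  most \<open>k * ((card U - 2) choose (k - 2))\<close> of these, too few for the assumed
  degree.\<close>

lemma cross_intersecting_star_left:
  assumes "finite U" "uniform_family U k \<A>" "uniform_family U k \<B>"
    and "cross_intersecting \<A> \<B>" "2 \<le> k" "4 * k * (k - 1) \<le> card U - 1"
    and "4 * codegree \<B> {i} > (card U - 1) choose (k - 1)" "S \<in> \<A>"
  shows "i \<in> S"
proof (rule ccontr)
  assume i: "i \<notin> S"
  note fS = uniform_family_member[OF assms(1,2,8)]
  have "codegree \<B> {i} \<le> card S * ((card U - 2) choose (k - 2))"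
  proof (rule codegree_extend[OF assms(4) finite_uniform_family[OF assms(1,3)] assms(8) fS(1)])
    fix j assume "j \<in> S"
    then have "j \<noteq> i" using i by blast
    then have "card {j, i} = 2" by simp
    then show "codegree \<B> {j, i} \<le> (card U - 2) choose (k - 2)"
      using codegree_le_choose[OF assms(1,3), of "{j, i}"] by simp
  qed
  moreover have "4 * k * ((card U - 2) choose (k - 2)) \<le> (card U - 1) choose (k - 1)"
    using power_mult_choose_le[of "4 * k" "k - 1" "card U - 1" 1] assms(5,6)
    by (simp add: numeral_2_eq_2)
  ultimately show False using assms(7) fS(2) by simp
qed

text \<open>With \<open>k = s + 1\<close> this lets a family of at least \<open>N / 3\<close> sets
  with degrees at most \<open>N / 4 ^ s\<close> avoid every set of \<open>s + 1\<close>
  elements.\<close>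

lemma three_mult_less_four_power: "3 \<le> k \<Longrightarrow> 3 * k < (4::nat) ^ (k - 1)"
proof (induction k rule: dec_induct)
  case (step k)
  then have "(4::nat) ^ (Suc k - 1) = 4 * 4 ^ (k - 1)"
    by (cases k) auto
  then show ?case using step by simp
qed simp

lemma cross_intersecting_star:
  fixes U :: "'a set"
  assumes U: "finite U" and AB: "uniform_family U k \<A>" "uniform_family U k \<B>"
    and cross: "cross_intersecting \<A> \<B>" and k: "3 \<le> k" "4 * k * (k - 1) \<le> card U - 1"
    and N: "N = (card U - 1) choose (k - 1)"
    and size: "N \<le> 3 * card \<A>" "N \<le> 3 * card \<B>" "N < card \<A> + card \<B>"
  shows "\<exists>i. \<forall>S\<in>\<A> \<union> \<B>. i \<in> S"
proof (rule ccontr)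
  assume no_star: "\<not> ?thesis"
  have cross': "cross_intersecting \<B> \<A>"
    using cross by (simp add: cross_intersecting_commute)
  note fin = finite_uniform_family[OF U AB(1)] finite_uniform_family[OF U AB(2)]
  have "N > 0"
  proof -
    have "k - 1 \<le> 4 * k * (k - 1)" using k(1) by simp
    then show ?thesis using k(2) unfolding N by (subst zero_less_binomial_iff) linarith
  qed
  \<comment> \<open>An element \<open>i\<close> of large degree in \<open>\<C>\<close> lies in all
    of \<open>\<D>\<close>. Its degree there is at least \<open>N / 3\<close>, again large, so
    \<open>i\<close> lies in all of \<open>\<C>\<close> too.\<close>
  have deg1: "4 * codegree \<C> {i} \<le> N"
    if CD: "uniform_family U k \<C>" "uniform_family U k \<D>" "cross_intersecting \<C> \<D>"
      "cross_intersecting \<D> \<C>" "\<C> \<union> \<D> = \<A> \<union> \<B>" "N \<le> 3 * card \<D>" for \<C> \<D> i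
  proof (rule ccontr)
    assume big: "\<not> 4 * codegree \<C> {i} \<le> N"
    have D: "i \<in> S" if "S \<in> \<D>" for S
      using cross_intersecting_star_left[OF U CD(2,1,4) _ k(2), of i S] k(1) big that
      unfolding N by simp
    then have "{S \<in> \<D>. {i} \<subseteq> S} = \<D>" by auto
    then have "4 * codegree \<D> {i} > N" using CD(6) \<open>N > 0\<close> by (simp add: codegree_def)
    then have "i \<in> S" if "S \<in> \<C>" for S
      using cross_intersecting_star_left[OF U CD(1,2,3) _ k(2), of i S] k(1) that
      unfolding N by simp
    then show False using no_star D CD(5) by blast
  qed
  note up = degree_le_if_avoids_all[OF U _ _ _ _ _ k(2), folded N]
  \<comment> \<open>With \<open>N / 3\<close> members and degrees up to \<open>N / 4\<close>, only
    single elements are surely avoided, which merely returns \<open>N / 4\<close>. A family of more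
    than \<open>N / 2\<close> members avoids all pairs, so the other one drops to
    \<open>N / 16\<close>; its \<open>N / 3\<close> members then avoid all pairs too.\<close>
  have deg2: "16 * codegree \<C> {i} \<le> N \<and> 16 * codegree \<D> {i} \<le> N"
    if CD: "uniform_family U k \<C>" "uniform_family U k \<D>" "cross_intersecting \<C> \<D>"
      "cross_intersecting \<D> \<C>" "\<C> \<union> \<D> = \<A> \<union> \<B>" "N \<le> 3 * card \<C>" "N \<le> 3 * card \<D>"
      "N < 2 * card \<C>" for \<C> \<D> i
  proof -
    note fin = finite_uniform_family[OF U CD(1)] finite_uniform_family[OF U CD(2)]
    have "avoids_all \<C> 2"
      using deg1[OF CD(1-5,7)] CD(8) by (intro avoids_all_if_scaled_degrees[OF fin(1), of 4 N]) auto
    then have D: "4\<^sup>2 * codegree \<D> {i} \<le> N" for i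
      using k(1) by (intro up[OF CD(1,2,3)]) auto
    have "avoids_all \<D> 2"
      using D CD(7) \<open>N > 0\<close> by (intro avoids_all_if_scaled_degrees[OF fin(2), of "4\<^sup>2" N]) auto
    then have "4\<^sup>2 * codegree \<C> {i} \<le> N" for i
      using k(1) by (intro up[OF CD(2,1,4)]) auto
    with D show ?thesis by simp
  qed
  have two: "16 * codegree \<A> {i} \<le> N \<and> 16 * codegree \<B> {i} \<le> N" for i
  proof (cases "N < 2 * card \<A>")
    case True
    then show ?thesis using deg2[OF AB cross cross' _ size(1,2)] by simp
  next
    case False
    then have "N < 2 * card \<B>" using size(3) by simp
    then show ?thesis using deg2[OF AB(2,1) cross' cross _ size(2,1)] by (simp add: Un_commute)
  qed
  \<comment> \<open>The start at \<open>2\<close> matters: \<open>3 * (s + 1) < 4 ^ s\<close> fails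
    for \<open>s = 1\<close>.\<close>
  have all: "(\<forall>i. 4 ^ s * codegree \<A> {i} \<le> N) \<and> (\<forall>i. 4 ^ s * codegree \<B> {i} \<le> N)"
    if "2 \<le> s" "s < k" for s
    using that
  proof (induction s rule: dec_induct)
    case (step s)
    have *: "Suc s * N < 4 ^ s * card \<C>" if "N \<le> 3 * card \<C>" for \<C> :: "'a set set"
    proof -
      have "3 * Suc s < 4 ^ s" using three_mult_less_four_power[of "Suc s"] step.hyps by simp
      then have "3 * Suc s * N < 4 ^ s * N" using \<open>N > 0\<close> mult_less_mono1 by blast
      also have "\<dots> \<le> 4 ^ s * (3 * card \<C>)" using that by simp
      finally show ?thesis by linarith
    qed
    have "avoids_all \<A> (Suc s)" "avoids_all \<B> (Suc s)"
      using step * size by (auto intro!: avoids_all_if_scaled_degrees[OF fin(1), of "4 ^ s" N]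
          avoids_all_if_scaled_degrees[OF fin(2), of "4 ^ s" N])
    then show ?case using up[OF AB cross, of "Suc s"] up[OF AB(2,1) cross', of "Suc s"] step by blast
  qed (use two in simp)
  \<comment> \<open>The exponent \<open>k - 1\<close> is enough for \<open>\<A>\<close> to avoid
    every \<open>k\<close>-element set, in particular a member of \<open>\<B>\<close>.\<close>
  have "k * N < 4 ^ (k - 1) * card \<A>"
  proof -
    have "3 * k * N < 4 ^ (k - 1) * N"
      using three_mult_less_four_power[OF k(1)] \<open>N > 0\<close> mult_less_mono1 by blast
    also have "\<dots> \<le> 4 ^ (k - 1) * (3 * card \<A>)" using size by simp
    finally show ?thesis by linarith
  qed
  then have "avoids_all \<A> k"
    using all[of "k - 1"] k(1) by (intro avoids_all_if_scaled_degrees[OF fin(1), of "4 ^ (k - 1)" N]) auto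
  moreover obtain T where "T \<in> \<B>" using size(2) \<open>N > 0\<close> by fastforce
  moreover have "finite T" "card T = k"
    using uniform_family_member[OF U AB(2) \<open>T \<in> \<B>\<close>] by auto
  ultimately obtain S where "S \<in> \<A>" "S \<inter> T = {}" unfolding avoids_all_def by blast
  then show False using cross \<open>T \<in> \<B>\<close> by (auto simp: cross_intersecting_def)
qed

text \<open>A common element places the disjoint union of both families among the at most
  \<open>N\<close> sets through that element.\<close>

lemma cross_intersecting_card_le:
  fixes U :: "'a set"
  assumes "finite U" "uniform_family U k \<A>" "uniform_family U k \<B>"
    and "cross_intersecting \<A> \<B>" "\<A> \<inter> \<B> = {}" "3 \<le> k" "4 * k * (k - 1) \<le> card U - 1"
    and N: "N = (card U - 1) choose (k - 1)"
    and size: "N \<le> 3 * card \<A>" "N \<le> 3 * card \<B>"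
  shows "card \<A> + card \<B> \<le> N"
proof (rule ccontr)
  assume less: "\<not> ?thesis"
  then obtain i where i: "\<forall>S\<in>\<A> \<union> \<B>. i \<in> S"
    using cross_intersecting_star[OF assms(1-4,6-7) N size] by auto
  then have "{S \<in> \<A> \<union> \<B>. {i} \<subseteq> S} = \<A> \<union> \<B>" by auto
  moreover have "uniform_family U k (\<A> \<union> \<B>)"
    using assms(2,3) by (auto simp: uniform_family_def)
  ultimately have "card (\<A> \<union> \<B>) \<le> N"
    using codegree_le_choose[OF assms(1), of k "\<A> \<union> \<B>" "{i}"] N by (simp add: codegree_def)
  then show False using less assms(5) finite_uniform_family[OF assms(1)] assms(2,3)
    by (simp add: card_Un_disjoint)
qed

section \<open>Balanced separations from tree decompositions\<close>

text \<open>Arcs come in opposite pairs, so the symmetrization inside \<open>connected\<close>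
  changes nothing, and connectivity becomes a closure open to rule induction.\<close>

lemma connected_induced_iff:
  assumes "pair_graph T"
  shows "connected (with_proj T \<restriction> U) \<longleftrightarrow>
    U \<noteq> {} \<and> (\<forall>u\<in>U. \<forall>v\<in>U. (u, v) \<in> (parcs T \<inter> U \<times> U)\<^sup>*)"
proof -
  interpret pair_graph T by fact
  let ?S = "with_proj (mk_symmetric (with_proj T \<restriction> U))"
  have arcs: "arcs_ends ?S = parcs T \<inter> U \<times> U"
    using arcs_symmetric by (fastforce simp: parcs_mk_symmetric)
  have "u \<rightarrow>\<^sup>*\<^bsub>?S\<^esub> v \<longleftrightarrow> (u, v) \<in> (parcs T \<inter> U \<times> U)\<^sup>*" if "u \<in> U" for u v
  proof
    show "u \<rightarrow>\<^sup>*\<^bsub>?S\<^esub> v \<Longrightarrow> (u, v) \<in> (parcs T \<inter> U \<times> U)\<^sup>*"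
      using reachable_rtranclI[of ?S u v] by (simp only: arcs)
    show "(u, v) \<in> (parcs T \<inter> U \<times> U)\<^sup>* \<Longrightarrow> u \<rightarrow>\<^sup>*\<^bsub>?S\<^esub> v"
    proof (induction rule: rtrancl_induct)
      case (step v w)
      then show ?case
        unfolding reachable_def arcs by (auto intro: rtrancl_on_into_rtrancl_on)
    qed (use that in \<open>simp add: reachable_def rtrancl_on.intros\<close>)
  qed
  then show ?thesis by (auto simp: connected_def strongly_connected_def)
qed

text \<open>The component of \<open>y\<close> after deleting \<open>x\<close>, when \<open>x\<close>
  and \<open>y\<close> are distinct nodes.\<close>

definition branch :: "'x pair_pre_digraph \<Rightarrow> 'x \<Rightarrow> 'x \<Rightarrow> 'x set" where
  "branch T x y = {z. (y, z) \<in> (parcs T \<inter> (- {x}) \<times> (- {x}))\<^sup>*}"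

lemma branch_self: "y \<in> branch T x y"
  by (simp add: branch_def)

lemma branch_step:
  assumes "u \<in> branch T x y" "(u, v) \<in> parcs T" "u \<noteq> x" "v \<noteq> x"
  shows "v \<in> branch T x y"
  using assms by (auto simp: branch_def intro: rtrancl.rtrancl_into_rtrancl)

lemma branch_induct [consumes 1, case_names base step]:
  assumes "z \<in> branch T x y" "P y"
    and "\<And>u v. u \<in> branch T x y \<Longrightarrow> (u, v) \<in> parcs T \<Longrightarrow> u \<noteq> x \<Longrightarrow> v \<noteq> x \<Longrightarrow> P u \<Longrightarrow> P v"
  shows "P z"
proof -
  have "(y, z) \<in> (parcs T \<inter> (- {x}) \<times> (- {x}))\<^sup>*" using assms(1) by (simp add: branch_def)
  then show ?thesis
    by (induction rule: rtrancl_induct) (use assms(2,3) in \<open>auto simp: branch_def\<close>)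
qed

lemma not_in_branch:
  assumes "x \<noteq> y"
  shows "x \<notin> branch T x y"
proof -
  have "z \<noteq> x" if "z \<in> branch T x y" for z
    using that by (induction rule: branch_induct) (use assms in auto)
  then show ?thesis by blast
qed

text \<open>Paths inside \<open>W\<close> avoid \<open>x\<close>, so they cannot leave the
  branch.\<close>

lemma branch_subset_if_closed:
  assumes "W \<inter> branch T x y \<noteq> {}" "x \<notin> W"
    and "\<And>u v. u \<in> W \<Longrightarrow> v \<in> W \<Longrightarrow> (u, v) \<in> (parcs T \<inter> W \<times> W)\<^sup>*"
  shows "W \<subseteq> branch T x y"
proof
  fix w assume "w \<in> W"
  obtain u where u: "u \<in> W" "u \<in> branch T x y" using assms(1) by blast
  have "(u, w) \<in> (parcs T \<inter> W \<times> W)\<^sup>*" using assms(3) u(1) \<open>w \<in> W\<close> .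
  then show "w \<in> branch T x y"
    by (induction rule: rtrancl_induct) (use u(2) assms(2) branch_step in \<open>fast+\<close>)
qed

locale utree =
  fixes T :: "'x pair_pre_digraph"
  assumes undirected_tree: "undirected_tree T"
begin

lemma pair_graph: "pair_graph T"
  using undirected_tree by (simp add: undirected_tree_def)

sublocale pair_graph T
  by (rule pair_graph)

lemma pverts_nonempty: "pverts T \<noteq> {}"
  and rtrancl_arcs: "u \<in> pverts T \<Longrightarrow> v \<in> pverts T \<Longrightarrow> (u, v) \<in> (parcs T)\<^sup>*"
proof -
  have "with_proj T \<restriction> pverts T = with_proj T"
    using in_arcsD1 in_arcsD2 by (auto simp: induce_subgraph_def with_proj_def)
  then have "connected (with_proj T \<restriction> pverts T)"
    using undirected_tree by (simp add: undirected_tree_def)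
  then have *: "pverts T \<noteq> {} \<and> (\<forall>u\<in>pverts T. \<forall>v\<in>pverts T. (u, v) \<in> (parcs T \<inter> pverts T \<times> pverts T)\<^sup>*)"
    using connected_induced_iff[OF pair_graph, of "pverts T"] by blast
  then show "pverts T \<noteq> {}" by blast
  show "(u, v) \<in> (parcs T)\<^sup>*" if "u \<in> pverts T" "v \<in> pverts T"
    using * that rtrancl_mono[of "parcs T \<inter> pverts T \<times> pverts T" "parcs T"] by blast
qed

lemma branch_sym:
  assumes "z \<in> branch T x y"
  shows "y \<in> branch T x z"
proof -
  have "sym (parcs T \<inter> (- {x}) \<times> (- {x}))"
    using arcs_symmetric by (auto simp: sym_def)
  then show ?thesis
    using assms sym_rtrancl by (auto simp: branch_def dest: symD)
qed

lemma branch_trans: "z \<in> branch T x y \<Longrightarrow> w \<in> branch T x z \<Longrightarrow> w \<in> branch T x y"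
  by (auto simp: branch_def)

lemma branch_subset_pverts:
  assumes "(x, y) \<in> parcs T"
  shows "branch T x y \<subseteq> pverts T"
proof
  fix z assume "z \<in> branch T x y"
  then show "z \<in> pverts T"
    by (induction rule: branch_induct) (use assms in_arcsD2 in auto)
qed

text \<open>Otherwise a non-trivial path from \<open>y\<close> to \<open>y'\<close> avoiding
  \<open>x\<close>, closed by the arcs at \<open>x\<close>, is a cycle of length at least 3.\<close>

lemma neighbours_in_distinct_branches:
  assumes "(x, y) \<in> parcs T" "(x, y') \<in> parcs T" "y' \<in> branch T x y"
  shows "y = y'"
proof (rule ccontr)
  assume "y \<noteq> y'"
  let ?H = "with_proj T \<restriction> (pverts T - {x})"
  interpret H: wf_digraph ?H by (rule wellformed_induce_subgraph)
  have ends: "arcs_ends ?H = parcs T \<inter> (- {x}) \<times> (- {x})"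
    using in_arcsD1 in_arcsD2 by (auto simp: arcs_ends_conv image_iff)
  have "y \<in> verts ?H" using assms(1) in_arcsD2 no_loops' by fastforce
  then have "y \<rightarrow>\<^sup>*\<^bsub>?H\<^esub> y'"
    using assms(3) by (simp add: H.reachable_conv' ends branch_def)
  then obtain p where p: "H.apath y p y'" by (auto simp: H.reachable_apath)
  have sub: "subgraph ?H (with_proj T)"
    by (rule induced_imp_subgraph) auto
  have "apath y p y'" using p sub by (rule subgraph_apath_imp_apath)
  moreover have "x \<notin> set (pawalk_verts y p)"
  proof -
    have "H.awalk_verts = awalk_verts"
      using compatible_awalk_verts[OF compatible_induce_subgraph[of "with_proj T"]] by simp
    then show ?thesis using p by (auto simp: H.apath_def H.awalk_conv)
  qed
  ultimately have "awalk x ((x, y) # p @ [(y', x)]) x"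
    "distinct (tl (pawalk_verts x ((x, y) # p @ [(y', x)])))"
    using assms(1) arcs_symmetric[OF assms(2)] in_arcsD1[OF assms(1)]
    by (auto simp: apath_def awalk_simps awalk_verts_append)
  moreover have "p \<noteq> []" using \<open>apath y p y'\<close> \<open>y \<noteq> y'\<close> by (auto simp: apath_simps)
  then have "3 \<le> length ((x, y) # p @ [(y', x)])" by (cases p) auto
  ultimately have "\<exists>p. cycle p \<and> 3 \<le> length p" unfolding cycle_def by blast
  then show False using undirected_tree by (simp add: undirected_tree_def)
qed

lemma branches_disjoint:
  assumes "(x, y) \<in> parcs T" "(x, y') \<in> parcs T" "y \<noteq> y'"
  shows "branch T x y \<inter> branch T x y' = {}"
  using neighbours_in_distinct_branches[OF assms(1,2)] assms(3) branch_sym branch_trans by blast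

lemma branch_cover:
  assumes "x \<in> pverts T" "z \<in> pverts T" "z \<noteq> x"
  shows "\<exists>y. (x, y) \<in> parcs T \<and> z \<in> branch T x y"
proof -
  \<comment> \<open>The disjunct \<open>z = x\<close> keeps the induction going when the walk
    returns to \<open>x\<close>; leaving \<open>x\<close> again starts a new branch.\<close>
  have "z = x \<or> (\<exists>y. (x, y) \<in> parcs T \<and> z \<in> branch T x y)"
    using rtrancl_arcs[OF assms(1,2)]
  proof (induction rule: rtrancl_induct)
    case (step u v)
    show ?case
    proof (cases "u = x \<or> v = x")
      case True
      then show ?thesis using step.hyps branch_self by fast
    next
      case False
      then show ?thesis using step branch_step by fast
    qed
  qed simp
  then show ?thesis using assms(3) by blast
qed

text \<open>To be applied to the nodes whose bags contain a given vertex: a vertex missed at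
  \<open>x\<close> lives behind a single neighbour of \<open>x\<close>.\<close>

lemma connected_subset_branch:
  assumes "connected (with_proj T \<restriction> W)" "W \<subseteq> pverts T" "x \<in> pverts T" "x \<notin> W"
  shows "\<exists>y. (x, y) \<in> parcs T \<and> W \<subseteq> branch T x y"
proof -
  have W: "W \<noteq> {}" "\<And>u v. u \<in> W \<Longrightarrow> v \<in> W \<Longrightarrow> (u, v) \<in> (parcs T \<inter> W \<times> W)\<^sup>*"
    using assms(1) by (auto simp: connected_induced_iff[OF pair_graph])
  then obtain w where w: "w \<in> W" by blast
  then obtain y where "(x, y) \<in> parcs T" "w \<in> branch T x y"
    using branch_cover assms(2-4) by blast
  then show ?thesis using branch_subset_if_closed[of W T x y] W(2) w assms(4) by blast
qed

text \<open>A node reached from \<open>y\<close> without passing \<open>x\<close> is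
  \<open>y\<close> or lies in a branch at \<open>y\<close> other than that of
  \<open>x\<close>.\<close>

lemma opposite_branches_disjoint:
  assumes "(x, y) \<in> parcs T"
  shows "branch T x y \<inter> branch T y x = {}"
proof -
  have yx: "(y, x) \<in> parcs T" "x \<noteq> y" using assms arcs_symmetric no_loops' by auto
  have "w = y \<or> (\<exists>z. (y, z) \<in> parcs T \<and> z \<noteq> x \<and> w \<in> branch T y z)" if "w \<in> branch T x y" for w
    using that
  proof (induction rule: branch_induct)
    case (step u v)
    show ?case
    proof (cases "u = y \<or> v = y")
      case True
      then show ?thesis using step.hyps branch_self by fast
    next
      case False
      then show ?thesis using step branch_step by fast
    qed
  qed simp
  moreover have "w \<notin> branch T y x" if "(y, z) \<in> parcs T" "z \<noteq> x" "w \<in> branch T y z" for w z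
    using branches_disjoint[OF yx(1) that(1)] that(2,3) by blast
  moreover have "y \<notin> branch T y x" using not_in_branch[of y x T] yx(2) by blast
  ultimately show ?thesis by (metis disjoint_iff)
qed

text \<open>A walk from \<open>z\<close> avoiding \<open>y\<close> never reaches \<open>x\<close>,
  which lies in another branch at \<open>y\<close>. The node \<open>y\<close> makes the inclusion
  strict.\<close>

lemma branch_psubset:
  assumes "(x, y) \<in> parcs T" "(y, z) \<in> parcs T" "z \<noteq> x"
  shows "branch T y z \<subset> branch T x y"
proof (rule psubsetI)
  have neq: "x \<noteq> y" "y \<noteq> z" using assms no_loops' by auto
  have x: "x \<notin> branch T y z"
    using branches_disjoint[OF arcs_symmetric[OF assms(1)] assms(2)] assms(3) branch_self[of x T y] by blast
  show "branch T y z \<subseteq> branch T x y"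
  proof
    fix w assume "w \<in> branch T y z"
    then show "w \<in> branch T x y"
    proof (induction rule: branch_induct)
      case base
      show ?case by (rule branch_step[OF branch_self assms(2)]) (use neq assms(3) in auto)
    next
      case (step u v)
      have "v \<in> branch T y z" by (rule branch_step[OF step.hyps])
      then show ?case
        by (intro branch_step[OF step.IH step.hyps(2)]) (use step.hyps(1) x in auto)
    qed
  qed
  show "branch T y z \<noteq> branch T x y"
    using branch_self[of y T x] not_in_branch[of y z T] neq by auto
qed

end

section \<open>Balanced groups and separations\<close>

text \<open>Greedy choice: stop when the sum first reaches \<open>m / 3\<close>; the last item adds
  at most \<open>m / 3\<close>.\<close>

lemma balanced_subset_sum_small:
  fixes f :: "'a \<Rightarrow> nat"
  assumes "finite I" "m \<le> 3 * sum f I" "\<And>i. i \<in> I \<Longrightarrow> 3 * f i \<le> m"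
  shows "\<exists>J\<subseteq>I. m \<le> 3 * sum f J \<and> 3 * sum f J \<le> 2 * m"
  using assms
proof (induction I rule: finite_induct)
  case (insert i I)
  show ?case
  proof (cases "m \<le> 3 * sum f I")
    case True
    then show ?thesis using insert by (meson insertCI subset_insertI2)
  next
    case False
    then have "3 * sum f (insert i I) \<le> 2 * m"
      using insert.hyps insert.prems(2)[of i] by simp
    then show ?thesis using insert.prems(1) by blast
  qed
qed auto

text \<open>An item of at least a third of the total is taken alone; otherwise all items are small
  enough for the greedy choice.\<close>

lemma balanced_subset_sum:
  fixes f :: "'a \<Rightarrow> nat"
  assumes "finite I" "\<And>i. i \<in> I \<Longrightarrow> 3 * f i \<le> 2 * sum f I"
  shows "\<exists>J\<subseteq>I. sum f I \<le> 3 * sum f J \<and> 3 * sum f J \<le> 2 * sum f I"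
proof (cases "\<exists>i\<in>I. sum f I \<le> 3 * f i")
  case True
  then obtain i where "i \<in> I" "sum f I \<le> 3 * f i" by blast
  then show ?thesis using assms(2) by (intro exI[of _ "{i}"]) auto
next
  case False
  then show ?thesis
    using assms(1) by (intro balanced_subset_sum_small) (auto simp: not_le intro: less_imp_le)
qed

text \<open>Vertices living in disjoint branches share no bag, so no edge joins them. It remains to
  find disjoint branches, or groups of branches at one node, of suitable weight.\<close>

lemma tree_decomposition_balanced_separation:
  fixes T :: "'x pair_pre_digraph"
  assumes G: "pair_graph G" and td: "tree_decomposition G T B"
    and M: "\<And>x. x \<in> pverts T \<Longrightarrow> M \<le> card (pverts G - B x)"
  shows "\<exists>P Q. P \<subseteq> pverts G \<and> Q \<subseteq> pverts G \<and> P \<inter> Q = {} \<and> parcs G \<inter> P \<times> Q = {} \<and>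
    M \<le> 3 * card P \<and> M \<le> 3 * card Q \<and> M \<le> card P + card Q"
proof -
  interpret G: pair_graph G by fact
  interpret T: utree T using td by unfold_locales (simp add: tree_decomposition_def)
  let ?V = "pverts G" and ?E = "parcs T"
  define nodes where "nodes v = {x \<in> pverts T. v \<in> B x}" for v
  have conn: "connected (with_proj T \<restriction> nodes v)" if "v \<in> ?V" for v
    using td that by (simp add: tree_decomposition_def nodes_def)
  have nodes: "nodes v \<noteq> {}" "nodes v \<subseteq> pverts T" if "v \<in> ?V" for v
    using conn[OF that] by (auto simp: connected_induced_iff[OF T.pair_graph] nodes_def)
  have arc: "nodes u \<inter> nodes v \<noteq> {}" if "(u, v) \<in> parcs G" for u v
    using td that by (fastforce simp: tree_decomposition_def nodes_def)
  \<comment> \<open>For a neighbour \<open>y\<close> of \<open>x\<close>, these are the vertices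
    missed at \<open>x\<close> that live behind \<open>y\<close>.\<close>
  define hid where "hid x y = {v \<in> ?V. nodes v \<subseteq> branch T x y}" for x y
  have hidV: "hid x y \<subseteq> ?V" for x y by (auto simp: hid_def)
  have fin: "finite (hid x y)" for x y
    using finite_subset[OF hidV] G.pair_finite_verts by blast
  have sep: "hid x y \<inter> hid x' y' = {}" "parcs G \<inter> hid x y \<times> hid x' y' = {}"
    if "branch T x y \<inter> branch T x' y' = {}" for x y x' y'
    using that nodes arc unfolding hid_def by blast+
  have cover: "?V - B x = (\<Union>y\<in>{y. (x, y) \<in> ?E}. hid x y)" if x: "x \<in> pverts T" for x
  proof (intro equalityI subsetI)
    fix v assume v: "v \<in> ?V - B x"
    then have "x \<notin> nodes v" by (simp add: nodes_def)
    then show "v \<in> (\<Union>y\<in>{y. (x, y) \<in> ?E}. hid x y)"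
      using T.connected_subset_branch[OF conn _ x] nodes v by (fastforce simp: hid_def)
  next
    fix v assume "v \<in> (\<Union>y\<in>{y. (x, y) \<in> ?E}. hid x y)"
    then obtain y where y: "(x, y) \<in> ?E" "v \<in> ?V" "nodes v \<subseteq> branch T x y" by (auto simp: hid_def)
    then have "x \<notin> nodes v" using not_in_branch[of x y T] T.no_loops' by blast
    then show "v \<in> ?V - B x" using x y(2) by (simp add: nodes_def)
  qed
  have finN: "finite {y. (x, y) \<in> ?E}" for x
    by (rule finite_subset[OF _ T.pair_finite_verts]) (auto dest: T.in_arcsD2)
  have card_UN: "card (\<Union>y\<in>J. hid x y) = (\<Sum>y\<in>J. card (hid x y))" if "J \<subseteq> {y. (x, y) \<in> ?E}" for x J
  proof (rule card_UN_disjoint)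
    show "\<forall>y\<in>J. \<forall>y'\<in>J. y \<noteq> y' \<longrightarrow> hid x y \<inter> hid x y' = {}"
      using that by (intro ballI impI sep(1) T.branches_disjoint) auto
  qed (use finite_subset[OF that finN] fin in auto)
  show ?thesis
  proof (rule ccontr)
    assume contr: "\<not> ?thesis"
    have none: False if "P \<subseteq> ?V" "Q \<subseteq> ?V" "P \<inter> Q = {}" "parcs G \<inter> P \<times> Q = {}"
      "M \<le> 3 * card P" "M \<le> 3 * card Q" "M \<le> card P + card Q" for P Q
      using contr that by blast
    \<comment> \<open>If every branch carries at most two thirds of the missed vertices, some group
      of branches carries between one and two thirds and leaves at least a third to the
      rest.\<close>
    have heavy: "\<exists>y. (x, y) \<in> ?E \<and> 2 * M < 3 * card (hid x y)" if x: "x \<in> pverts T" for x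
    proof (rule ccontr)
      assume light: "\<not> ?thesis"
      let ?N = "{y. (x, y) \<in> ?E}" and ?f = "\<lambda>y. card (hid x y)"
      have m: "sum ?f ?N = card (?V - B x)" using card_UN[of ?N x] cover[OF x] by simp
      then have "3 * ?f y \<le> 2 * sum ?f ?N" if "y \<in> ?N" for y
        using light M[OF x] that by fastforce
      then obtain J where J: "J \<subseteq> ?N" "sum ?f ?N \<le> 3 * sum ?f J" "3 * sum ?f J \<le> 2 * sum ?f ?N"
        using balanced_subset_sum[OF finN, of x ?f] by blast
      let ?P = "\<Union>y\<in>J. hid x y" and ?Q = "\<Union>y\<in>?N - J. hid x y"
      have "sum ?f J + sum ?f (?N - J) = sum ?f ?N"
        using sum.subset_diff[OF J(1) finN, of ?f] by simp
      moreover have "card ?P = sum ?f J" "card ?Q = sum ?f (?N - J)"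
        using J(1) by (auto intro!: card_UN)
      ultimately have size: "M \<le> 3 * card ?P" "M \<le> 3 * card ?Q" "M \<le> card ?P + card ?Q"
        using J(2,3) M[OF x] m by linarith+
      have "hid x y \<inter> hid x y' = {} \<and> parcs G \<inter> hid x y \<times> hid x y' = {}"
        if "y \<in> J" "y' \<in> ?N - J" for y y'
        using sep[OF T.branches_disjoint, of x y y'] that J(1) by blast
      then have "?P \<inter> ?Q = {}" "parcs G \<inter> ?P \<times> ?Q = {}" by blast+
      moreover have "?P \<subseteq> ?V" "?Q \<subseteq> ?V" using hidV by blast+
      ultimately show False using none[of ?P ?Q] size by blast
    qed
    \<comment> \<open>Among the heavy arcs take one with the smallest branch. The heavy arc leaving
      its head \<open>y\<close> must return to \<open>x\<close>, since any other has a strictly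
      smaller branch.\<close>
    define H where "H = {(x, y). (x, y) \<in> ?E \<and> 2 * M < 3 * card (hid x y)}"
    have "H \<noteq> {}" using heavy T.pverts_nonempty by (fastforce simp: H_def)
    then obtain e where e: "e \<in> H"
      and least: "\<And>e'. e' \<in> H \<Longrightarrow>
        card (case_prod (branch T) e) \<le> card (case_prod (branch T) e')"
      using ex_has_least_nat[of "\<lambda>e. e \<in> H" _ "\<lambda>e. card (case_prod (branch T) e)"] by blast
    obtain x y where "e = (x, y)" by (cases e)
    then have xy: "(x, y) \<in> H" using e by simp
    have min: "card (branch T x y) \<le> card (branch T x' y')" if "(x', y') \<in> H" for x' y'
      using least[OF that] \<open>e = (x, y)\<close> by simp
    from xy have E: "(x, y) \<in> ?E" by (simp add: H_def)
    obtain z where z: "(y, z) \<in> H" using heavy[of y] T.in_arcsD2[OF E] by (auto simp: H_def)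
    have "z = x"
    proof (rule ccontr)
      assume "z \<noteq> x"
      then have "branch T y z \<subset> branch T x y" using T.branch_psubset E z by (simp add: H_def)
      moreover have "finite (branch T x y)"
        using T.branch_subset_pverts[OF E] T.pair_finite_verts finite_subset by blast
      ultimately show False using min[OF z] psubset_card_mono by (metis not_le)
    qed
    then have "2 * M < 3 * card (hid x y)" "2 * M < 3 * card (hid y x)"
      using xy z by (auto simp: H_def)
    then have "M \<le> 3 * card (hid x y)" "M \<le> 3 * card (hid y x)" "M \<le> card (hid x y) + card (hid y x)"
      by linarith+
    then show False
      using none[OF hidV hidV] sep[OF T.opposite_branches_disjoint[OF E]] by blast
  qed
qed

section \<open>The treewidth of Kneser graphs\<close>

text \<open>Node \<open>0\<close> is the centre, and \<open>m\<close> counts the leaves.\<close>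

definition star_graph :: "nat \<Rightarrow> nat pair_pre_digraph" where
  "star_graph m = \<lparr> pverts = {..m}, parcs = ({0} \<times> {1..m}) \<union> ({1..m} \<times> {0}) \<rparr>"

lemma star_graph_simps [simp]:
  "pverts (star_graph m) = {..m}"
  "parcs (star_graph m) = ({0} \<times> {1..m}) \<union> ({1..m} \<times> {0})"
  by (simp_all add: star_graph_def)

lemma pair_graph_star_graph: "pair_graph (star_graph m)"
  by unfold_locales (auto simp: symmetric_def sym_def)

lemma connected_star_graph_induced:
  assumes "W \<noteq> {}" "W \<subseteq> {..m}" "0 \<in> W \<or> (\<exists>x. W = {x})"
  shows "connected (with_proj (star_graph m) \<restriction> W)"
proof -
  have "(u, v) \<in> (parcs (star_graph m) \<inter> W \<times> W)\<^sup>*" if "u \<in> W" "v \<in> W" for u v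
  proof (cases "0 \<in> W")
    case True
    let ?R = "parcs (star_graph m) \<inter> W \<times> W"
    have "(u, 0) \<in> ?R\<^sup>*" "(0, v) \<in> ?R\<^sup>*"
      using that True assms(2) by (cases "u = 0"; cases "v = 0"; force intro: r_into_rtrancl)+
    then show ?thesis by (rule rtrancl_trans)
  next
    case False
    then show ?thesis using assms(3) that by auto
  qed
  then show ?thesis
    using assms(1) by (simp add: connected_induced_iff[OF pair_graph_star_graph])
qed

lemma undirected_tree_star_graph: "undirected_tree (star_graph m)"
proof -
  interpret pair_graph "star_graph m" by (rule pair_graph_star_graph)
  have "connected (with_proj (star_graph m) \<restriction> {..m})"
    by (rule connected_star_graph_induced) auto
  moreover have "with_proj (star_graph m) \<restriction> {..m} = with_proj (star_graph m)"
    by (auto simp: induce_subgraph_def with_proj_def)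
  \<comment> \<open>Every second node of a walk is the centre. A closed walk of at least three arcs
    meets it twice after the first node: as second and fourth node from a leaf, as third and last
    from the centre.\<close>
  moreover have "\<not> (cycle p \<and> 3 \<le> length p)" for p
  proof
    assume "cycle p \<and> 3 \<le> length p"
    then obtain u a b c q where p: "p = a # b # c # q" and w: "awalk u p u"
      and d: "distinct (tl (pawalk_verts u p))"
      by (auto simp: cycle_def Suc_le_length_iff numeral_3_eq_3)
    have "last (pawalk_verts u p) = u" using w by (rule awlast_of_awalk) (simp add: NOMATCH_def)
    then have "u \<in> set (pawalk_verts (snd c) q)"
      using last_in_set[of "pawalk_verts (snd c) q"] awalk_verts_non_Nil[of "snd c" q] p by auto
    moreover have "awalk (snd c) q u" using w unfolding p awalk_Cons_iff by blast
    then have "snd c \<in> set (pawalk_verts (snd c) q)" by (rule hd_in_awalk_verts)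
    ultimately show False using w d by (auto simp: p awalk_Cons_iff)
  qed
  ultimately show ?thesis using pair_graph_star_graph by (auto simp: undirected_tree_def)
qed

text \<open>Widths are integers, so evaluating \<open>LEAST\<close> takes a decomposition that
  attains the minimum.\<close>

lemma treewidth_eqI:
  fixes T :: "nat pair_pre_digraph"
  assumes "tree_decomposition G T B" "decomposition_width T B = w"
    and "\<And>(T :: nat pair_pre_digraph) B. tree_decomposition G T B \<Longrightarrow> w \<le> decomposition_width T B"
  shows "treewidth G = w"
  unfolding treewidth_def using assms by (intro Least_equality) auto

definition independent_set :: "'a pair_pre_digraph \<Rightarrow> 'a set \<Rightarrow> bool" where
  "independent_set G I \<longleftrightarrow> I \<subseteq> pverts G \<and> parcs G \<inter> I \<times> I = {}"

text \<open>The centre carries the complement of \<open>I\<close>, and each leaf carries some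
  \<open>v\<close> in \<open>I\<close> with its neighbours. The strict degree bound leaves room for
  \<open>v\<close> itself.\<close>

lemma tree_decomposition_independent_set:
  assumes "pair_graph G" "independent_set G I"
    and degree: "\<And>v. v \<in> I \<Longrightarrow> card {u. (v, u) \<in> parcs G} < card (pverts G - I)"
  shows "\<exists>(T :: nat pair_pre_digraph) B. tree_decomposition G T B \<and>
    decomposition_width T B = int (card (pverts G - I)) - 1"
proof -
  interpret pair_graph G by fact
  let ?V = "pverts G" and ?T = "star_graph (card I)"
  have I: "I \<subseteq> ?V" "\<And>u v. u \<in> I \<Longrightarrow> v \<in> I \<Longrightarrow> (u, v) \<notin> parcs G"
    using assms(2) by (auto simp: independent_set_def)
  have fI: "finite I" using I(1) pair_finite_verts by (rule finite_subset)
  obtain g where g: "bij_betw g {1..card I} I"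
    using ex_bij_betw_nat_finite_1[OF fI] by blast
  let ?N = "\<lambda>v. {u. (v, u) \<in> parcs G}"
  define B where "B x = (if x = 0 then ?V - I else insert (g x) (?N (g x)))" for x
  have gI: "g x \<in> I" if "x \<in> {1..card I}" for x using g that by (auto simp: bij_betw_def)
  have g_surj: "\<exists>x\<in>{1..card I}. g x = v" if "v \<in> I" for v
  proof -
    have "v \<in> g ` {1..card I}" using g that by (simp add: bij_betw_def)
    then show ?thesis by blast
  qed
  have N: "?N v \<subseteq> ?V - I" if "v \<in> I" for v using that I(2) in_arcsD2 by blast
  have td: "tree_decomposition G ?T B"
    unfolding tree_decomposition_def
  proof (intro conjI ballI)
    show "undirected_tree ?T" by (rule undirected_tree_star_graph)
    fix x assume "x \<in> pverts ?T"
    show "B x \<subseteq> ?V"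
    proof (cases "x = 0")
      case False
      then have "g x \<in> I" using gI[of x] \<open>x \<in> pverts ?T\<close> by auto
      then show ?thesis using N[of "g x"] I(1) False unfolding B_def by auto
    qed (simp add: B_def)
  next
    fix v assume v: "v \<in> ?V"
    show "connected (with_proj ?T \<restriction> {x \<in> pverts ?T. v \<in> B x})"
    proof (cases "v \<in> I")
      case True
      then obtain x where x: "x \<in> {1..card I}" "g x = v" using g_surj by blast
      \<comment> \<open>\<open>v\<close> is not in the centre bag and, by independence, is a
        neighbour of no element of \<open>I\<close>; only its own leaf holds it.\<close>
      have "y = x" if "y \<in> pverts ?T" "v \<in> B y" for y
      proof -
        have y: "y \<in> {1..card I}" using that True by (cases "y = 0") (auto simp: B_def)
        then have "v \<in> insert (g y) (?N (g y))" using that(2) by (simp add: B_def)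
        moreover have "v \<notin> ?N (g y)" using N[OF gI[OF y]] True by blast
        ultimately have "g y = g x" using x(2) by simp
        then show ?thesis by (rule inj_onD[OF bij_betw_imp_inj_on[OF g] _ y x(1)])
      qed
      moreover have "x \<in> pverts ?T" "v \<in> B x" using x by (auto simp: B_def)
      ultimately have "{x \<in> pverts ?T. v \<in> B x} = {x}" by blast
      then show ?thesis using x(1) by (simp only:) (rule connected_star_graph_induced, auto)
    next
      case False
      then show ?thesis using v by (intro connected_star_graph_induced) (auto simp: B_def)
    qed
  next
    fix e assume e: "e \<in> parcs G"
    obtain u v where uv: "e = (u, v)" by (cases e)
    have "\<exists>x\<in>{..card I}. u \<in> B x \<and> v \<in> B x"
    proof -
      consider "u \<in> I" | "v \<in> I" | "u \<notin> I" "v \<notin> I" by blast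
      then show ?thesis
      proof cases
        case 1
        then obtain x where "x \<in> {1..card I}" "g x = u" using g_surj by blast
        then show ?thesis using e uv by (intro bexI[of _ x]) (auto simp: B_def)
      next
        case 2
        then obtain x where "x \<in> {1..card I}" "g x = v" using g_surj by blast
        then show ?thesis using e uv arcs_symmetric by (intro bexI[of _ x]) (auto simp: B_def)
      next
        case 3
        then show ?thesis using e uv in_arcsD1 in_arcsD2
          by (intro bexI[of _ 0]) (auto simp: B_def)
      qed
    qed
    then show "case e of (u, v) \<Rightarrow> \<exists>x\<in>pverts ?T. u \<in> B x \<and> v \<in> B x" by (simp add: uv)
  qed
  have "card (B x) \<le> card (?V - I)" if "x \<in> {..card I}" for x
  proof (cases "x = 0")
    case False
    then have "g x \<in> I" using gI that by auto
    moreover from this have "finite (?N (g x))"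
      using finite_subset[OF N] pair_finite_verts by blast
    then have "card (insert (g x) (?N (g x))) \<le> Suc (card (?N (g x)))"
      by (simp add: card_insert_if)
    ultimately have "card (insert (g x) (?N (g x))) \<le> card (?V - I)"
      using degree[of "g x"] by linarith
    then show ?thesis using False by (simp add: B_def)
  qed (simp add: B_def)
  moreover have "B 0 = ?V - I" by (simp add: B_def)
  ultimately have "Max ((\<lambda>x. int (card (B x))) ` {..card I}) = int (card (?V - I))"
    by (intro Max_eqI) (auto intro!: image_eqI[of _ _ 0])
  then have "decomposition_width ?T B = int (card (?V - I)) - 1"
    by (simp add: decomposition_width_def)
  with td show ?thesis by blast
qed

section \<open>Width bounds for Kneser graphs\<close>

lemma kneser_simps [simp]:
  "pverts (kneser n k) = {S. S \<subseteq> {1..n} \<and> card S = k}"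
  "(S, R) \<in> parcs (kneser n k) \<longleftrightarrow>
    S \<subseteq> {1..n} \<and> card S = k \<and> R \<subseteq> {1..n} \<and> card R = k \<and> S \<inter> R = {}"
  by (auto simp: kneser_def Let_def)

lemma card_kneser_diff_star:
  assumes "n \<ge> 1"
  shows "card (pverts (kneser n k) - {S. 1 \<in> S}) = (n - 1) choose k"
proof -
  have "pverts (kneser n k) - {S. 1 \<in> S} = {S. S \<subseteq> {2..n} \<and> card S = k}"
  proof -
    have "S \<subseteq> {1..n} \<and> 1 \<notin> S \<longleftrightarrow> S \<subseteq> {2..n}" for S :: "nat set"
      by (force simp: subset_iff Suc_le_eq numeral_2_eq_2 order_le_less)
    then show ?thesis by auto
  qed
  then show ?thesis by (simp add: n_subsets)
qed

text \<open>The sets containing \<open>1\<close> pairwise meet, so they form an independent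
  set.\<close>

lemma kneser_width_le:
  assumes "2 \<le> k" "2 * k \<le> n"
  shows "\<exists>(T :: nat pair_pre_digraph) B. tree_decomposition (kneser n k) T B \<and>
    decomposition_width T B = int ((n - 1) choose k) - 1"
proof -
  let ?G = "kneser n k" and ?I = "{S \<in> pverts (kneser n k). 1 \<in> S}"
  have G: "pair_graph ?G" using assms by (intro pair_graph_kneser) simp
  have diff: "pverts ?G - ?I = pverts ?G - {S. 1 \<in> S}" by auto
  have "independent_set ?G ?I" by (auto simp: independent_set_def)
  moreover have "card {R. (S, R) \<in> parcs ?G} < card (pverts ?G - ?I)" if "S \<in> ?I" for S
  proof (rule psubset_card_mono)
    show "finite (pverts ?G - ?I)" by simp
    have S: "S \<subseteq> {1..n}" "card S = k" "1 \<in> S" using that by auto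
    then have fS: "finite S" using finite_subset by blast
    have "\<not> {1..n} \<subseteq> S"
      using card_mono[OF fS, of "{1..n}"] S(2) assms by auto
    then obtain z where z: "z \<in> {1..n}" "z \<notin> S" by blast
    \<comment> \<open>Replacing \<open>1\<close> by \<open>z\<close> gives a set without
      \<open>1\<close> that still meets \<open>S\<close>, as \<open>k \<ge> 2\<close>. This makes
      the degree bound strict.\<close>
    let ?R = "insert z (S - {1})"
    have "card ?R = k" using z S fS assms(1) by (simp add: card_Diff_singleton)
    then have R: "?R \<in> pverts ?G - ?I" using z S by auto
    have "S - {1} \<noteq> {}"
    proof
      assume "S - {1} = {}"
      then have "S = {1}" using S(3) by blast
      then show False using S(2) assms(1) by simp
    qed
    then have "(S, ?R) \<notin> parcs ?G" by auto
    moreover have "{R. (S, R) \<in> parcs ?G} \<subseteq> pverts ?G - ?I" using S(3) by auto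
    ultimately show "{R. (S, R) \<in> parcs ?G} \<subset> pverts ?G - ?I" using R by blast
  qed
  ultimately have "\<exists>(T :: nat pair_pre_digraph) B. tree_decomposition ?G T B \<and>
      decomposition_width T B = int (card (pverts ?G - ?I)) - 1"
    using G by (intro tree_decomposition_independent_set)
  then show ?thesis using card_kneser_diff_star[of n k] assms by (simp only: diff)
qed

text \<open>In a Kneser graph, families with no edge between them are cross-intersecting, so a
  balanced separation contradicts the size bound for such families.\<close>

lemma kneser_width_ge:
  fixes T :: "'x pair_pre_digraph"
  assumes k: "3 \<le> k" "4 * k * (k - 1) \<le> n - 1" and td: "tree_decomposition (kneser n k) T B"
  shows "int ((n - 1) choose k) - 1 \<le> decomposition_width T B"
proof (rule ccontr)
  assume small: "\<not> ?thesis"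
  let ?G = "kneser n k" and ?N = "(n - 1) choose (k - 1)"
  have n: "n \<ge> 1" using k by (cases n) auto
  interpret G: pair_graph ?G using k(1) by (intro pair_graph_kneser) simp
  have "finite (pverts T)"
    using td by (auto simp: tree_decomposition_def undirected_tree_def pair_graph_def pair_digraph_def
      pair_fin_digraph_def pair_fin_digraph_axioms_def)
  \<comment> \<open>By Pascal's rule a bag smaller than \<open>(n - 1) choose k\<close> misses at
    least \<open>Suc ?N\<close> vertices, one more than the size bound permits.\<close>
  have V: "card (pverts ?G) = ?N + ((n - 1) choose k)"
    using n k(1) choose_reduce_nat[of n k] by (simp add: n_subsets)
  have "Suc ?N \<le> card (pverts ?G - B x)" if x: "x \<in> pverts T" for x
  proof -
    have "int (card (B x)) \<le> Max ((\<lambda>x. int (card (B x))) ` pverts T)"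
      using \<open>finite (pverts T)\<close> x by (intro Max_ge) auto
    then have "card (B x) < (n - 1) choose k" using small by (simp add: decomposition_width_def)
    moreover have "B x \<subseteq> pverts ?G" using td x by (simp add: tree_decomposition_def)
    ultimately show ?thesis
      using V card_Diff_subset[of "B x" "pverts ?G"] finite_subset[OF _ G.pair_finite_verts, of "B x"]
      by linarith
  qed
  then obtain P Q where PQ: "P \<subseteq> pverts ?G" "Q \<subseteq> pverts ?G" "P \<inter> Q = {}"
      "parcs ?G \<inter> P \<times> Q = {}" "Suc ?N \<le> 3 * card P" "Suc ?N \<le> 3 * card Q"
      "Suc ?N \<le> card P + card Q"
    using tree_decomposition_balanced_separation[OF G.pair_graph td, of "Suc ?N"] by blast
  have "uniform_family {1..n} k P" "uniform_family {1..n} k Q"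
    using PQ(1,2) by (auto simp: uniform_family_def)
  moreover have "S \<inter> R \<noteq> {}" if "S \<in> P" "R \<in> Q" for S R
  proof -
    have "(S, R) \<notin> parcs ?G" using that PQ(4) by blast
    then show ?thesis using that PQ(1,2) by auto
  qed
  then have "cross_intersecting P Q" by (simp add: cross_intersecting_def)
  ultimately have "card P + card Q \<le> ?N"
    using cross_intersecting_card_le[of "{1..n}" k P Q ?N] PQ k by simp
  then show False using PQ(7) by simp
qed

theorem theorem1:
  fixes n k :: nat
  assumes "k \<ge> 3"
    and "int n \<ge> 4 * int k ^ 2 - 4 * int k + 3"
  shows "treewidth (kneser n k) = int ((n - 1) choose k) - 1"
proof -
  \<comment> \<open>Factoring carries the integer hypothesis over to natural numbers, in the product
    form of the codegree bounds.\<close>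
  have "int (4 * k * (k - 1)) = 4 * int k ^ 2 - 4 * int k"
    using assms(1) by (simp add: of_nat_diff power2_eq_square algebra_simps)
  then have n: "4 * k * (k - 1) + 3 \<le> n" using assms(2) by linarith
  have "2 * k \<le> 4 * k * (k - 1)" using assms(1) by simp
  then have "2 * k \<le> n" using n by linarith
  then obtain T :: "nat pair_pre_digraph" and B where
    "tree_decomposition (kneser n k) T B" "decomposition_width T B = int ((n - 1) choose k) - 1"
    using kneser_width_le[of k n] assms(1) by auto
  moreover have "4 * k * (k - 1) \<le> n - 1" using n by linarith
  ultimately show ?thesis
    using kneser_width_ge[of k n] assms(1) by (intro treewidth_eqI) blast+
qed

end
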